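(* Let $p>1$ and let $n\ge2$ be an integer. Consider the function $\|\cdot\|_2^p:\mathbb{R}^n\to\mathbb{R}$, and the function $|\cdot|^p:\mathbb{R}\to\mathbb{R}$. Then $\alpha(\|\cdot\|_2^p)=\alpha(|\cdot|^p)$.
   Context: $\|\cdot\|_2$ denotes the Euclidean norm. For a differentiable strictly convex function $h:\mathbb{R}^d\to\mathbb{R}$, the Bregman distance is $D_h(x,y):=h(x)-h(y)-\langle\nabla h(y),x-y\rangle$ and the symmetry coefficient is $$\alpha(h):=\inf\left\{\frac{D_h(x,y)}{D_h(y,x)}\;\middle|\;x,y\in\mathbb{R}^d,\ x\neq y\right\}.$$ This applies to $\|\cdot\|_2^p$ on $\mathbb{R}^n$ and to $|\cdot|^p$ on $\mathbb{R}$ for $p>1$. *)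

theory Defs
  imports "HOL-Analysis.Analysis"
begin

text \<open>
  The total functions below carry their intended meaning for differentiable, strictly convex
  \<open>h\<close>. For such \<open>h\<close> the gradient exists and is unique at every point, and every quotient in
  \<open>symmetry_coeff\<close> has positive numerator and denominator, so that the infimum is taken over a
  set of positive reals, which is nonempty if the space is not trivial.
\<close>

definition gradient :: "('a::euclidean_space \<Rightarrow> real) \<Rightarrow> 'a \<Rightarrow> 'a" where
  "gradient h y = (THE D. GDERIV h y :> D)"

lemma gradient_eqI:
  assumes "GDERIV h y :> D"
  shows "gradient h y = D"
proof -
  have "D' = D" if "GDERIV h y :> D'" for D'
  proof -
    have "(\<lambda>v. v \<bullet> D') = (\<lambda>v. v \<bullet> D)"
      using assms that has_derivative_unique unfolding gderiv_def by blast
    then show ?thesis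
      by (metis inner_commute vector_eq_rdot)
  qed
  with assms show ?thesis
    unfolding gradient_def by blast
qed

definition bregman_distance :: "('a::euclidean_space \<Rightarrow> real) \<Rightarrow> 'a \<Rightarrow> 'a \<Rightarrow> real" where
  "bregman_distance h x y = h x - h y - gradient h y \<bullet> (x - y)"

definition symmetry_coeff :: "('a::euclidean_space \<Rightarrow> real) \<Rightarrow> real" where
  "symmetry_coeff h = Inf {bregman_distance h x y / bregman_distance h y x | x y. x \<noteq> y}"

end

theory Submission
  imports Defs
begin

text \<open>
  Put \<open>a = \<parallel>x\<parallel>\<close>, \<open>b = \<parallel>y\<parallel>\<close> and \<open>s = \<langle>x, y\<rangle>\<close>. The gradient of \<open>\<parallel>\<cdot>\<parallel>\<^sup>p\<close> at \<open>y\<close> is a multiple of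
  \<open>y\<close>, so the Bregman distance depends on \<open>(a, b, s)\<close> only, and for fixed \<open>a\<close> and \<open>b\<close> it is affine
  in \<open>s\<close>. A quotient of two affine functions with positive denominator has no interior strict
  minimum: if the quotient equals \<open>r\<close> at \<open>s\<close>, then numerator minus \<open>r\<close> times denominator is
  affine and vanishes at \<open>s\<close>, hence is nonpositive at one end of the Cauchy--Schwarz interval
  \<open>-ab \<le> s \<le> ab\<close>. The two ends are exactly the configurations of the real numbers \<open>a\<close> and
  \<open>\<plusminus>b\<close>. So each quotient in Euclidean space is bounded below by a quotient on the line
  (\<open>ratio_dominated_by_line\<close>), while the line embeds isometrically in the space
  (\<open>ratio_on_line_embeds\<close>). Strict convexity of \<open>t\<^sup>p\<close> on the half-line makes the denominators
  positive. The only degenerate end is \<open>s = ab\<close> with \<open>a = b\<close>; there both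
  distances coincide and the other end serves.
\<close>

lemma GDERIV_norm_powr:
  fixes y :: "'a::euclidean_space"
  assumes "p > 1"
  shows "GDERIV (\<lambda>x. norm x powr p) y :> (p * norm y powr (p - 2)) *\<^sub>R y"
proof (cases "y = 0")
  case True
  have "((\<lambda>h::'a. norm h powr (p - 1)) \<longlongrightarrow> 0) (at 0)"
    using assms by (intro tendsto_zero_powrI[where b = "p - 1"]) (auto intro!: tendsto_eq_intros)
  moreover have "norm h powr p / norm h = norm h powr (p - 1)" for h :: 'a
    by (cases "h = 0") (simp_all add: powr_diff)
  ultimately show ?thesis
    using True assms by (simp add: gderiv_def has_derivative_at)
next
  case False
  have "((\<lambda>x::'a. norm x powr p) has_derivative
      (\<lambda>h. norm y powr p * (0 * ln (norm y) + (h \<bullet> sgn y) * p / norm y))) (at y)"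
    using False by (intro has_derivative_powr has_derivative_norm has_derivative_const) auto
  moreover have "norm y powr p * (0 * ln (norm y) + (h \<bullet> sgn y) * p / norm y)
      = h \<bullet> ((p * norm y powr (p - 2)) *\<^sub>R y)" for h
    using False by (simp add: sgn_div_norm powr_diff inner_commute power2_eq_square field_simps)
  ultimately show ?thesis
    by (simp add: gderiv_def)
qed

text \<open>
  The Bregman distance of \<open>\<parallel>\<cdot>\<parallel>\<^sup>p\<close> in terms of the two norms \<open>a\<close>, \<open>b\<close> and the inner product \<open>s\<close>,
  which are treated as independent numbers so that \<open>s\<close> can move while \<open>a\<close> and \<open>b\<close> stay fixed.
\<close>

definition radial_bregman :: "real \<Rightarrow> real \<Rightarrow> real \<Rightarrow> real \<Rightarrow> real" where
  "radial_bregman p a b s = a powr p + (p - 1) * b powr p - p * b powr (p - 2) * s"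

lemma bregman_distance_norm_powr:
  fixes x y :: "'a::euclidean_space"
  assumes "p > 1"
  shows "bregman_distance (\<lambda>x. norm x powr p) x y = radial_bregman p (norm x) (norm y) (x \<bullet> y)"
proof -
  have "norm y powr (p - 2) * (y \<bullet> y) = norm y powr p"
    by (cases "y = 0") (simp_all add: powr_diff power2_norm_eq_inner)
  then have "p * (norm y powr (p - 2) * (y \<bullet> y)) = p * norm y powr p"
    by simp
  then show ?thesis
    unfolding bregman_distance_def radial_bregman_def gradient_eqI[OF GDERIV_norm_powr[OF assms]]
    by (simp add: inner_diff_right inner_commute algebra_simps)
qed

text \<open>
  The graph of \<open>t\<^sup>p\<close> lies strictly above its tangents. The mean value theorem is used in its
  form with an open interval of differentiability, because an endpoint may be \<open>0\<close>.
\<close>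

lemma powr_above_tangent:
  fixes a b p :: real
  assumes "p > 1" "a \<ge> 0" "b \<ge> 0" "a \<noteq> b"
  shows "a powr p > b powr p + p * b powr (p - 1) * (a - b)"
proof -
  have mvt: "\<exists>c. u < c \<and> c < v \<and> v powr p - u powr p = (v - u) * (p * c powr (p - 1))"
    if "0 \<le> u" "u < v" for u v
  proof -
    have "\<exists>l c. u < c \<and> c < v \<and> ((\<lambda>t. t powr p) has_real_derivative l) (at c)
        \<and> v powr p - u powr p = (v - u) * l"
      using that assms(1)
      by (intro MVT continuous_on_powr' continuous_intros)
        (auto intro!: exI has_real_derivative_powr simp: real_differentiable_def)
    then obtain l c where c: "u < c" "c < v" "((\<lambda>t. t powr p) has_real_derivative l) (at c)"
      "v powr p - u powr p = (v - u) * l" by blast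
    moreover have "l = p * c powr (p - 1)"
      using c that by (intro DERIV_unique[OF c(3)] has_real_derivative_powr) auto
    ultimately show ?thesis by blast
  qed
  show ?thesis
  proof (cases "b < a")
    case True
    then obtain c where c: "b < c" "a powr p - b powr p = (a - b) * (p * c powr (p - 1))"
      using mvt assms by blast
    then have "b powr (p - 1) < c powr (p - 1)"
      using assms by (intro powr_less_mono2) auto
    then have "(a - b) * (p * b powr (p - 1)) < (a - b) * (p * c powr (p - 1))"
      using True assms by simp
    then show ?thesis using c by (simp add: algebra_simps)
  next
    case False
    then have "a < b" using assms by simp
    then obtain c where c: "a < c" "c < b" "b powr p - a powr p = (b - a) * (p * c powr (p - 1))"
      using mvt assms by blast
    then have "c powr (p - 1) < b powr (p - 1)"
      using assms by (intro powr_less_mono2) auto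
    then have "(b - a) * (p * c powr (p - 1)) < (b - a) * (p * b powr (p - 1))"
      using \<open>a < b\<close> assms by simp
    then show ?thesis using c by (simp add: algebra_simps)
  qed
qed

text \<open>
  Decreasing in \<open>s\<close>, the distance is smallest at \<open>s = ab\<close>, where it is the gap between \<open>a\<^sup>p\<close> and
  the tangent at \<open>b\<close>. The gap closes for \<open>a = b\<close>, and then the slope \<open>- p b\<^sup>p\<^sup>-\<^sup>2\<close> in \<open>s\<close> makes the
  distance positive at \<open>s < ab\<close>; the lower bound on \<open>s\<close> forces \<open>b \<noteq> 0\<close> there.
\<close>

lemma radial_bregman_pos:
  assumes "p > 1" "a \<ge> 0" "b \<ge> 0" "\<bar>s\<bar> \<le> a * b" "a \<noteq> b \<or> s < a * b"
  shows "radial_bregman p a b s > 0"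
proof -
  have pow: "b powr (p - 2) * b = b powr (p - 1)" "b powr (p - 1) * b = b powr p"
    using assms by (cases "b = 0"; simp add: powr_diff power2_eq_square)+
  have end_value: "radial_bregman p a b (a * b)
      = a powr p - (b powr p + p * b powr (p - 1) * (a - b))"
    unfolding radial_bregman_def pow(2)[symmetric] pow(1)[symmetric]
    by (simp add: algebra_simps)
  have gap: "radial_bregman p a b s
      = radial_bregman p a b (a * b) + p * b powr (p - 2) * (a * b - s)"
    unfolding radial_bregman_def by (simp add: algebra_simps)
  show ?thesis
  proof (cases "a = b")
    case True
    then have "s < a * b" using assms by simp
    moreover have "b \<noteq> 0" using \<open>s < a * b\<close> assms by auto
    ultimately have "p * b powr (p - 2) * (a * b - s) > 0"
      using assms by simp
    then show ?thesis
      using True unfolding gap end_value by simp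
  next
    case False
    then have "radial_bregman p a b (a * b) > 0"
      using powr_above_tangent[of p a b] assms unfolding end_value by simp
    moreover have "p * b powr (p - 2) * (a * b - s) \<ge> 0"
      using assms by simp
    ultimately show ?thesis unfolding gap by linarith
  qed
qed

lemma bregman_distance_norm_powr_pos:
  fixes x y :: "'a::euclidean_space"
  assumes "p > 1" "x \<noteq> y"
  shows "bregman_distance (\<lambda>x. norm x powr p) x y > 0"
proof -
  have "x \<bullet> y \<noteq> norm x * norm y" if "norm x = norm y"
    using assms(2) that norm_cauchy_schwarz_eq[of x y] by auto
  then have "norm x \<noteq> norm y \<or> x \<bullet> y < norm x * norm y"
    using norm_cauchy_schwarz[of x y] by linarith
  then show ?thesis
    using assms Cauchy_Schwarz_ineq2[of x y]
    by (simp add: bregman_distance_norm_powr radial_bregman_pos)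
qed

lemma affine_nonpos_at_an_end:
  fixes c d s m :: real
  assumes "c + d * s = 0" "- m \<le> s" "s \<le> m"
  shows "c + d * m \<le> 0 \<or> c + d * (- m) \<le> 0"
proof (cases "d \<ge> 0")
  case True
  then have "d * (- m) \<le> d * s" using assms by (intro mult_left_mono) auto
  then show ?thesis using assms by linarith
next
  case False
  then have "d * m \<le> d * s" using assms by (intro mult_left_mono_neg) auto
  then show ?thesis using assms by linarith
qed

lemma ratio_dominated_by_line:
  fixes x y :: "'a::euclidean_space"
  assumes "p > 1" "x \<noteq> y"
  shows "\<exists>t u :: real. t \<noteq> u \<and>
    bregman_distance (\<lambda>t. \<bar>t\<bar> powr p) t u / bregman_distance (\<lambda>t. \<bar>t\<bar> powr p) u t
    \<le> bregman_distance (\<lambda>x. norm x powr p) x y / bregman_distance (\<lambda>x. norm x powr p) y x"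
proof -
  define a b s where "a = norm x" and "b = norm y" and "s = x \<bullet> y"
  define N M where "N = radial_bregman p a b" and "M = radial_bregman p b a"
  have ab: "a \<ge> 0" "b \<ge> 0" by (simp_all add: a_def b_def)
  have s: "s \<le> a * b" "- (a * b) \<le> s"
    using Cauchy_Schwarz_ineq2[of x y] by (auto simp: a_def b_def s_def)
  have D: "bregman_distance (\<lambda>x. norm x powr p) x y = N s"
    "bregman_distance (\<lambda>x. norm x powr p) y x = M s"
    using assms by (simp_all add: bregman_distance_norm_powr N_def M_def a_def b_def s_def
        inner_commute)
  have line: "bregman_distance (\<lambda>t. \<bar>t\<bar> powr p) t u = radial_bregman p \<bar>t\<bar> \<bar>u\<bar> (t * u)"
    for t u :: real
    using bregman_distance_norm_powr[of p t u] assms by simp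
  have Ms: "M s > 0"
    using bregman_distance_norm_powr_pos[of p y x] assms D by simp
  show ?thesis
  proof (cases "a = b")
    case True
    \<comment> \<open>Equal norms make the distance symmetric, so the quotient is 1, as for \<open>a\<close> and \<open>-a\<close>.\<close>
    then have "N s / M s = 1" using Ms by (simp add: N_def M_def)
    moreover have "a \<noteq> - a"
      using True assms by (auto simp: a_def b_def)
    moreover have "bregman_distance (\<lambda>t. \<bar>t\<bar> powr p) a (- a)
        / bregman_distance (\<lambda>t. \<bar>t\<bar> powr p) (- a) a \<le> 1"
      unfolding line by simp
    ultimately show ?thesis unfolding D by metis
  next
    case False
    define r where "r = N s / M s"
    define c where "c = N 0 - r * M 0"
    define d where "d = r * p * a powr (p - 2) - p * b powr (p - 2)"
    have aff: "N t - r * M t = c + d * t" for t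
      unfolding N_def M_def c_def d_def radial_bregman_def by (simp add: algebra_simps)
    have "c + d * s = 0"
      using Ms aff[of s] by (simp add: r_def)
    then have ends: "N (a * b) \<le> r * M (a * b) \<or> N (- (a * b)) \<le> r * M (- (a * b))"
      using affine_nonpos_at_an_end[of c d s "a * b"] s aff[of "a * b"] aff[of "- (a * b)"]
      by linarith
    have nonneg: "0 \<le> a * b" using ab by simp
    have pos: "M (a * b) > 0" "M (- (a * b)) > 0"
      unfolding M_def using assms ab False nonneg
      by (auto intro!: radial_bregman_pos simp: mult.commute)
    from ends show ?thesis
    proof
      assume "N (a * b) \<le> r * M (a * b)"
      then have "N (a * b) / M (a * b) \<le> r"
        using pos by (simp add: pos_divide_le_eq)
      then have "bregman_distance (\<lambda>t. \<bar>t\<bar> powr p) a b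
          / bregman_distance (\<lambda>t. \<bar>t\<bar> powr p) b a \<le> r"
        using ab by (simp add: line N_def M_def mult.commute)
      then show ?thesis unfolding D r_def using False by blast
    next
      assume "N (- (a * b)) \<le> r * M (- (a * b))"
      then have "N (- (a * b)) / M (- (a * b)) \<le> r"
        using pos by (simp add: pos_divide_le_eq)
      then have "bregman_distance (\<lambda>t. \<bar>t\<bar> powr p) a (- b)
          / bregman_distance (\<lambda>t. \<bar>t\<bar> powr p) (- b) a \<le> r"
        using ab by (simp add: line N_def M_def mult.commute)
      moreover have "a \<noteq> - b" using ab False by auto
      ultimately show ?thesis unfolding D r_def by blast
    qed
  qed
qed

lemma ratio_on_line_embeds:
  fixes t u p :: real
  assumes "p > 1" "t \<noteq> u"
  shows "\<exists>x y :: 'a::euclidean_space. x \<noteq> y \<and>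
    bregman_distance (\<lambda>t. \<bar>t\<bar> powr p) t u / bregman_distance (\<lambda>t. \<bar>t\<bar> powr p) u t
    = bregman_distance (\<lambda>x. norm x powr p) x y / bregman_distance (\<lambda>x. norm x powr p) y x"
proof -
  obtain e :: 'a where e: "e \<in> Basis" using nonempty_Basis by blast
  have "bregman_distance (\<lambda>x. norm x powr p) (v *\<^sub>R e) (w *\<^sub>R e)
      = bregman_distance (\<lambda>t. \<bar>t\<bar> powr p) v w" for v w
    using bregman_distance_norm_powr[of p v w] bregman_distance_norm_powr[of p "v *\<^sub>R e" "w *\<^sub>R e"]
      assms e by (simp add: inner_Basis mult.commute)
  moreover have "t *\<^sub>R e \<noteq> u *\<^sub>R e" using assms e by auto
  ultimately show ?thesis by metis
qed

text \<open>
  The dimension does not matter: the set of quotients on the line is contained in the set of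
  quotients in the space and is coinitial in it, and positivity bounds both sets below.
\<close>

lemma symmetry_coeff_norm_powr_eq_line:
  assumes "p > 1"
  shows "symmetry_coeff (\<lambda>x :: 'a::euclidean_space. norm x powr p)
    = symmetry_coeff (\<lambda>t :: real. \<bar>t\<bar> powr p)"
proof -
  define S where "S = {bregman_distance (\<lambda>x :: 'a. norm x powr p) x y
      / bregman_distance (\<lambda>x. norm x powr p) y x | x y. x \<noteq> y}"
  define L where "L = {bregman_distance (\<lambda>t :: real. \<bar>t\<bar> powr p) t u
      / bregman_distance (\<lambda>t. \<bar>t\<bar> powr p) u t | t u. t \<noteq> u}"
  have "L \<subseteq> S"
    unfolding L_def S_def using ratio_on_line_embeds[OF assms, where 'a = 'a] by fast
  have "L \<noteq> {}"
    unfolding L_def using zero_neq_one by blast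
  have "0 \<le> q" if "q \<in> S" for q
    using that assms unfolding S_def
    by (auto intro!: divide_nonneg_nonneg less_imp_le[OF bregman_distance_norm_powr_pos])
  then have "bdd_below S" by (rule bdd_belowI)
  have "Inf S = Inf L"
  proof (rule antisym)
    show "Inf S \<le> Inf L"
      using \<open>L \<noteq> {}\<close> \<open>bdd_below S\<close> \<open>L \<subseteq> S\<close> by (rule cInf_superset_mono)
    show "Inf L \<le> Inf S"
    proof (rule cInf_mono)
      show "S \<noteq> {}" using \<open>L \<noteq> {}\<close> \<open>L \<subseteq> S\<close> by blast
      show "bdd_below L" using \<open>bdd_below S\<close> \<open>L \<subseteq> S\<close> by (rule bdd_below_mono)
      show "\<exists>l\<in>L. l \<le> q" if "q \<in> S" for q
        using that ratio_dominated_by_line[OF assms, where 'a = 'a] unfolding S_def L_def by fast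
    qed
  qed
  then show ?thesis
    unfolding symmetry_coeff_def S_def L_def .
qed

theorem theorem5p1:
  fixes p :: real
  assumes "p > 1"
    and "CARD('n::finite) \<ge> 2"
  shows "symmetry_coeff (\<lambda>x :: real ^ 'n. norm x powr p) = symmetry_coeff (\<lambda>t :: real. \<bar>t\<bar> powr p)"
  using assms(1) by (rule symmetry_coeff_norm_powr_eq_line)

end
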